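(* Let $s\ge3$ be an integer. Then $2^{s+1}$ is the smallest period of the sequence $\{\beta_n\bmod 2^s\}_{n\ge0}$.
   Context: $t_n$ is the number of involutions of $[n]$ (permutations with $\pi^2=1$), $t_0=1$; ${\rm ord}_2(m)$ is the largest $e$ with $2^e\mid m$; $\beta_n=t_n/2^{{\rm ord}_2(t_n)}$ is the odd part of $t_n$. A period of a sequence $(a_n)_{n\ge0}$ is a positive integer $d$ with $a_{n+d}=a_n$ for all $n\ge0$. *)

theory Defs
  imports "HOL-Combinatorics.Permutations" "HOL-Computational_Algebra.Primes"
begin

definition involutions :: "nat \<Rightarrow> (nat \<Rightarrow> nat) set" where
  "involutions n = {p. p permutes {1..n} \<and> p \<circ> p = id}"

definition num_involutions :: "nat \<Rightarrow> nat" where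
  "num_involutions n = card (involutions n)"

definition odd_part_involutions :: "nat \<Rightarrow> nat" where
  "odd_part_involutions n = num_involutions n div 2 ^ multiplicity 2 (num_involutions n)"

definition is_period :: "(nat \<Rightarrow> 'a) \<Rightarrow> nat \<Rightarrow> bool" where
  "is_period a d \<longleftrightarrow> d > 0 \<and> (\<forall>n. a (n + d) = a n)"

definition is_smallest_period :: "(nat \<Rightarrow> 'a) \<Rightarrow> nat \<Rightarrow> bool" where
  "is_smallest_period a d \<longleftrightarrow> is_period a d \<and> (\<forall>d'. is_period a d' \<longrightarrow> d \<le> d')"

end

(* Since t(n+2) = t(n+1) + (n+1) t(n), the odd parts at 4j-2 and 4j-1 satisfy a linear recurrence in j
   whose matrix has integer polynomial entries. In terms of C(j) = beta(4j-2) and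
   E(j) = beta(4j-1) - beta(4j-2) this matrix is diag(1,0) mod 2. Suppose that shifting j by an even P
   changes C(j) and E(j) by 2P x(j) and 2P y(j) for all j >= 1. The recurrence then forces every y(j)
   to be odd and x(j+1) = x(j) + 1 (mod 2). Hence x(j) + x(j+P) and y(j) + y(j+P) are even, so shifting
   by 2P changes C and E by multiples of 4P: starting from P = 4, the period doubles with the modulus.
   The oddness of y(j) shows that P is not a period modulo 4P, which gives minimality for s >= 4;
   for s = 3 the values beta(0) = 1 and beta(8) = 191 differ modulo 8. *)

theory Submission
  imports Defs
begin

section \<open>Counting involutions of finite sets\<close>

text \<open>Arbitrary sets are allowed because deleting the partner of a point from an initial
  segment need not leave an initial segment.\<close>

definition involutions_on :: "'a set \<Rightarrow> ('a \<Rightarrow> 'a) set" where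
  "involutions_on S = {p. p permutes S \<and> p \<circ> p = id}"

lemma finite_involutions_on: "finite S \<Longrightarrow> finite (involutions_on S)"
  unfolding involutions_on_def
  by (rule finite_subset[OF _ finite_permutations[of S]]) auto

lemma involutions_on_empty: "involutions_on {} = {id}"
  by (auto simp: involutions_on_def)

text \<open>\<open>q\<close> fixes both \<open>a\<close> and \<open>b\<close>, so it commutes with
  the transposition. The second fact lets \<open>b\<close> be read off from the composite.\<close>

lemma transpose_comp_involution:
  assumes q: "q \<in> involutions_on (S - {b})" and ab: "a \<notin> S" "b \<in> S"
  shows "transpose a b \<circ> q \<in> involutions_on (insert a S)"
    and "(transpose a b \<circ> q) a = b"
proof -
  have perm: "q permutes S - {b}" and inv: "\<And>x. q (q x) = x"
    using q by (auto simp: involutions_on_def fun_eq_iff)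
  have fix_ab: "q a = a" "q b = b"
    using perm ab by (auto simp: permutes_def)
  have q_eq: "q x = a \<longleftrightarrow> x = a" "q x = b \<longleftrightarrow> x = b" for x
    using inv fix_ab by metis+
  have "transpose a b (q (transpose a b (q x))) = x" for x
    using inv[of x] fix_ab q_eq[of x] by (auto simp: transpose_def)
  moreover have "transpose a b \<circ> q permutes insert a S"
    using ab by (intro permutes_compose permutes_subset[OF perm] permutes_swap_id) auto
  ultimately show "transpose a b \<circ> q \<in> involutions_on (insert a S)"
    by (auto simp: involutions_on_def fun_eq_iff)
  show "(transpose a b \<circ> q) a = b"
    by (simp add: fix_ab)
qed

text \<open>An involution with \<open>p a = b\<close> also sends \<open>b\<close> to
  \<open>a\<close>. Composing with the transposition dissolves this 2-cycle and leaves both points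
  fixed.\<close>

lemma involution_decompose:
  assumes p: "p \<in> involutions_on (insert a S)" and pa: "p a = b" "b \<noteq> a"
  shows "transpose a b \<circ> p \<in> involutions_on (S - {b})" and "b \<in> S"
proof -
  have perm: "p permutes insert a S" and inv: "\<And>x. p (p x) = x"
    using p by (auto simp: involutions_on_def fun_eq_iff)
  have pb: "p b = a"
    using inv[of a] pa by simp
  have p_eq: "p x = a \<longleftrightarrow> x = b" "p x = b \<longleftrightarrow> x = a" for x
    using inv pa pb by metis+
  show "b \<in> S"
    using permutes_in_image[OF perm, of a] pa by auto
  have "transpose a b (p (transpose a b (p x))) = x" for x
    using inv[of x] pa pb p_eq[of x] by (auto simp: transpose_def)
  moreover have "transpose a b \<circ> p permutes insert a S"
    using \<open>b \<in> S\<close> by (intro permutes_compose[OF perm] permutes_swap_id) auto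
  then have "transpose a b \<circ> p permutes S - {b}"
    by (rule permutes_superset) (use pa pb in auto)
  ultimately show "transpose a b \<circ> p \<in> involutions_on (S - {b})"
    by (auto simp: involutions_on_def fun_eq_iff)
qed

text \<open>The new point \<open>a\<close> is either fixed or swapped with some \<open>b\<close> in
  \<open>S\<close>.\<close>

lemma involutions_on_insert:
  assumes "a \<notin> S"
  shows "involutions_on (insert a S) = involutions_on S \<union>
    (\<Union>b\<in>S. (\<lambda>q. transpose a b \<circ> q) ` involutions_on (S - {b}))" (is "?L = ?A \<union> ?B")
proof (intro equalityI subsetI)
  fix p assume p: "p \<in> ?L"
  show "p \<in> ?A \<union> ?B"
  proof (cases "p a = a")
    case True
    have "p permutes S"
      using p True by (auto simp: involutions_on_def intro: permutes_superset)
    with p show ?thesis by (auto simp: involutions_on_def)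
  next
    case False
    have "p = transpose a (p a) \<circ> (transpose a (p a) \<circ> p)"
      by (simp add: fun_eq_iff)
    with involution_decompose[OF p refl False] show ?thesis by blast
  qed
next
  fix p assume "p \<in> ?A \<union> ?B"
  moreover have "?A \<subseteq> ?L"
    by (auto simp: involutions_on_def intro: permutes_subset)
  ultimately show "p \<in> ?L"
    using transpose_comp_involution(1)[OF _ assms] by auto
qed

text \<open>The pieces of the decomposition are disjoint because they differ in the image of
  \<open>a\<close>.\<close>

lemma card_involutions_on_insert:
  assumes "finite S" "a \<notin> S"
  shows "card (involutions_on (insert a S)) =
    card (involutions_on S) + (\<Sum>b\<in>S. card (involutions_on (S - {b})))"
proof -
  let ?F = "\<lambda>b. (\<lambda>q. transpose a b \<circ> q) ` involutions_on (S - {b})"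
  have fin: "finite (?F b)" for b
    using assms by (simp add: finite_involutions_on)
  have at_a: "p a = b" if "p \<in> ?F b" "b \<in> S" for p b
    using that transpose_comp_involution(2)[OF _ assms(2)] by auto
  have inj: "inj_on (\<lambda>q. transpose a b \<circ> q) X" for b and X :: "('a \<Rightarrow> 'a) set"
    by (rule inj_on_subset[OF fun.inj_map]) (auto intro: bij_is_inj)
  have "involutions_on S \<inter> (\<Union>b\<in>S. ?F b) = {}"
    using assms(2) at_a by (fastforce simp: involutions_on_def permutes_def)
  then have "card (involutions_on (insert a S)) = card (involutions_on S) + card (\<Union>b\<in>S. ?F b)"
    unfolding involutions_on_insert[OF assms(2)]
    using assms fin by (intro card_Un_disjoint) (auto simp: finite_involutions_on)
  also have "card (\<Union>b\<in>S. ?F b) = (\<Sum>b\<in>S. card (?F b))"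
  proof (rule card_UN_disjoint[OF assms(1)])
    show "\<forall>b\<in>S. finite (?F b)"
      using fin by blast
    show "\<forall>b\<in>S. \<forall>c\<in>S. b \<noteq> c \<longrightarrow> ?F b \<inter> ?F c = {}"
      using at_a by (metis disjoint_iff)
  qed
  also have "\<dots> = (\<Sum>b\<in>S. card (involutions_on (S - {b})))"
    by (simp add: card_image inj)
  finally show ?thesis .
qed

text \<open>The counting recursion involves only smaller sets, so strong induction on the
  cardinality suffices and no conjugation by a bijection is carried out.\<close>

lemma card_involutions_on_cong:
  assumes "finite S" "finite T" "card S = card T"
  shows "card (involutions_on S) = card (involutions_on T)"
  using assms
proof (induction "card S" arbitrary: S T rule: less_induct)
  case less
  show ?case
  proof (cases "S = {}")
    case True
    with less.prems show ?thesis by (simp add: involutions_on_empty)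
  next
    case False
    then obtain a S' where S: "S = insert a S'" "a \<notin> S'" by (meson Set.set_insert equals0I)
    from False less.prems obtain b T' where T: "T = insert b T'" "b \<notin> T'"
      by (metis Set.set_insert card_eq_0_iff equals0I)
    have fin: "finite S'" "finite T'" "card S' = card T'"
      using less.prems S T by auto
    have "card (involutions_on (S' - {x})) = card (involutions_on (T' - {y}))"
      if "x \<in> S'" "y \<in> T'" for x y
      using that fin less.hyps[of "S' - {x}" "T' - {y}"] S by (simp add: less_Suc_eq_le)
    moreover obtain g where g: "bij_betw g S' T'"
      using fin finite_same_card_bij by blast
    ultimately have "(\<Sum>x\<in>S'. card (involutions_on (S' - {x}))) =
        (\<Sum>y\<in>T'. card (involutions_on (T' - {y})))"
      using bij_betwE[OF g]
      by (subst sum.reindex_bij_betw[OF g, symmetric]) (auto intro: sum.cong)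
    moreover have "card (involutions_on S') = card (involutions_on T')"
      using fin less.hyps[of S' T'] S by simp
    ultimately show ?thesis
      using S T fin by (simp add: card_involutions_on_insert)
  qed
qed

lemma num_involutions_eq_card:
  assumes "finite S" "card S = n"
  shows "card (involutions_on S) = num_involutions n"
  using card_involutions_on_cong[of S "{1..n}"] assms
  by (simp add: num_involutions_def involutions_def involutions_on_def)

lemma num_involutions_0: "num_involutions 0 = 1"
  using num_involutions_eq_card[of "{} :: nat set" 0] by (simp add: involutions_on_empty)

lemma num_involutions_1: "num_involutions (Suc 0) = 1"
proof -
  have "{p. p permutes {Suc 0} \<and> p \<circ> p = id} = {id}"
    by (auto simp: permutes_sing)
  then show ?thesis
    by (simp add: num_involutions_def involutions_def)
qed

lemma num_involutions_Suc_Suc: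
  "num_involutions (Suc (Suc n)) = num_involutions (Suc n) + Suc n * num_involutions n"
proof -
  have "num_involutions (Suc (Suc n)) = card (involutions_on (insert (Suc (Suc n)) {1..Suc n}))"
    by (intro num_involutions_eq_card[symmetric]) auto
  also have "\<dots> = card (involutions_on {1..Suc n}) +
      (\<Sum>b\<in>{1..Suc n}. card (involutions_on ({1..Suc n} - {b})))"
    by (intro card_involutions_on_insert) auto
  also have "\<dots> = num_involutions (Suc n) + (\<Sum>b\<in>{1..Suc n}. num_involutions n)"
    by (intro arg_cong2[where f = "(+)"] sum.cong refl num_involutions_eq_card) auto
  finally show ?thesis by simp
qed

section \<open>Integral recurrence for the odd parts\<close>

lemma int_num_involutions_rec:
  assumes "n \<ge> 2"
  shows "int (num_involutions n) =
    int (num_involutions (n - 1)) + (int n - 1) * int (num_involutions (n - 2))"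
proof -
  obtain m where "n = Suc (Suc m)"
    using assms by (metis add_2_eq_Suc le_Suc_ex)
  then show ?thesis
    by (simp add: num_involutions_Suc_Suc algebra_simps)
qed

text \<open>These are the numbers \<open>\<beta>(4j - 2)\<close> and \<open>\<beta>(4j - 1) - \<beta>(4j - 2)\<close>, extended to \<open>j = 0\<close> by running
  the recurrence backwards. Unlike for \<open>\<beta>(4j)\<close> and \<open>\<beta>(4j + 1)\<close>, from which \<open>\<beta>(4j + 2)\<close> arises by a
  division by 2, the other odd parts are integral combinations of them.\<close>

fun odd_part_mid :: "nat \<Rightarrow> int" and odd_part_gap :: "nat \<Rightarrow> int" where
  "odd_part_mid 0 = 1"
| "odd_part_gap 0 = 0"
| "odd_part_mid (Suc j) = (8 * int j ^ 2 + 10 * int j + 1) * odd_part_mid j + (8 * int j + 2) * odd_part_gap j"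
| "odd_part_gap (Suc j) = 2 * int j * (4 * int j + 1) * (odd_part_mid j + odd_part_gap j)"

lemma odd_odd_part_mid: "odd (odd_part_mid j)" and even_odd_part_gap: "even (odd_part_gap j)"
  by (induction j) auto

text \<open>Two consecutive values determine the next ones, so the induction carries the pair at
  \<open>4 * j\<close> and \<open>4 * j + 1\<close> through one block of four. All cofactors of the
  powers of 2 are odd.\<close>

lemma num_involutions_formula:
  "int (num_involutions (4 * j)) = 2 ^ j * ((4 * int j + 1) * odd_part_mid j + 2 * odd_part_gap j)"
  "int (num_involutions (4 * j + 1)) = 2 ^ j * ((12 * int j + 1) * odd_part_mid j + (8 * int j + 2) * odd_part_gap j)"
  "int (num_involutions (4 * j + 2)) = 2 ^ (j + 1) * odd_part_mid (Suc j)"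
  "int (num_involutions (4 * j + 3)) = 2 ^ (j + 2) * (odd_part_mid (Suc j) + odd_part_gap (Suc j))"
proof -
  let ?t = "\<lambda>n. int (num_involutions n)"
  let ?P = "\<lambda>j. ?t (4 * j) = 2 ^ j * ((4 * int j + 1) * odd_part_mid j + 2 * odd_part_gap j) \<and>
    ?t (4 * j + 1) = 2 ^ j * ((12 * int j + 1) * odd_part_mid j + (8 * int j + 2) * odd_part_gap j)"
  have upper: "?t (4 * j + 2) = 2 ^ (j + 1) * odd_part_mid (Suc j)"
    "?t (4 * j + 3) = 2 ^ (j + 2) * (odd_part_mid (Suc j) + odd_part_gap (Suc j))"
    if "?P j" for j
  proof -
    \<comment> \<open>The recurrence of \<open>odd_part_mid\<close> comes from here: (12j+1) +
      (4j+1)^2 = 2(8j^2+10j+1) and (8j+2) + 2(4j+1) = 2(8j+2). The extra factor 2 raises the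
      exponent to \<open>j + 1\<close>.\<close>
    have "?t (4 * j + 2) = ?t (4 * j + 1) + (4 * int j + 1) * ?t (4 * j)"
      using int_num_involutions_rec[of "4 * j + 2"] by (simp add: algebra_simps)
    then show two: "?t (4 * j + 2) = 2 ^ (j + 1) * odd_part_mid (Suc j)"
      unfolding that[THEN conjunct1] that[THEN conjunct2] by (simp add: power2_eq_square algebra_simps)
    have "?t (4 * j + 3) = ?t (4 * j + 2) + (4 * int j + 2) * ?t (4 * j + 1)"
      using int_num_involutions_rec[of "4 * j + 3"] by (simp add: algebra_simps)
    then show "?t (4 * j + 3) = 2 ^ (j + 2) * (odd_part_mid (Suc j) + odd_part_gap (Suc j))"
      unfolding two that[THEN conjunct2] by (simp add: power2_eq_square algebra_simps)
  qed
  have P: "?P j" for j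
  proof (induction j)
    case 0
    show ?case by (simp add: num_involutions_0 num_involutions_1)
  next
    case (Suc j)
    note up = upper[OF Suc]
    have "?t (4 * Suc j) = ?t (4 * j + 3) + (4 * int j + 3) * ?t (4 * j + 2)"
      using int_num_involutions_rec[of "4 * j + 4"] by (simp add: algebra_simps)
    also have "\<dots> = 2 ^ Suc j * ((4 * int (Suc j) + 1) * odd_part_mid (Suc j) + 2 * odd_part_gap (Suc j))"
      unfolding up by (simp add: algebra_simps del: odd_part_mid.simps odd_part_gap.simps)
    finally have zero: "?t (4 * Suc j) = \<dots>" .
    have "?t (4 * Suc j + 1) = ?t (4 * Suc j) + (4 * int j + 4) * ?t (4 * j + 3)"
      using int_num_involutions_rec[of "4 * j + 5"] by (simp add: algebra_simps)
    also have "\<dots> = 2 ^ Suc j * ((12 * int (Suc j) + 1) * odd_part_mid (Suc j) + (8 * int (Suc j) + 2) * odd_part_gap (Suc j))"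
      unfolding up zero by (simp add: algebra_simps del: odd_part_mid.simps odd_part_gap.simps)
    finally show ?case using zero by blast
  qed
  from P upper[OF P] show
    "?t (4 * j) = 2 ^ j * ((4 * int j + 1) * odd_part_mid j + 2 * odd_part_gap j)"
    "?t (4 * j + 1) = 2 ^ j * ((12 * int j + 1) * odd_part_mid j + (8 * int j + 2) * odd_part_gap j)"
    "?t (4 * j + 2) = 2 ^ (j + 1) * odd_part_mid (Suc j)"
    "?t (4 * j + 3) = 2 ^ (j + 2) * (odd_part_mid (Suc j) + odd_part_gap (Suc j))"
    by blast+
qed

text \<open>A factorisation into a power of 2 and an odd number is unique; \<open>x\<close> is
  nonnegative because the left side is.\<close>

lemma odd_part_involutions_eqI:
  assumes t: "int (num_involutions n) = 2 ^ k * x" and x: "odd x"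
  shows "int (odd_part_involutions n) = x"
proof -
  have "0 \<le> 2 ^ k * x" using t by (metis of_nat_0_le_iff)
  then have "0 \<le> x" by (simp add: zero_le_mult_iff)
  then obtain y where y: "x = int y" using nonneg_int_cases by blast
  have "int (num_involutions n) = int (2 ^ k * y)" using t y by simp
  then have t': "num_involutions n = 2 ^ k * y" by (simp only: of_nat_eq_iff)
  have "odd y" using x y by simp
  then have "multiplicity 2 (num_involutions n) = k"
    unfolding t' by (intro multiplicity_eqI) auto
  then show ?thesis by (simp add: odd_part_involutions_def t' y)
qed

lemma odd_part_formula:
  "int (odd_part_involutions (4 * j)) = (4 * int j + 1) * odd_part_mid j + 2 * odd_part_gap j"
  "int (odd_part_involutions (4 * j + 1)) = (12 * int j + 1) * odd_part_mid j + (8 * int j + 2) * odd_part_gap j"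
  "int (odd_part_involutions (4 * j + 2)) = odd_part_mid (Suc j)"
  "int (odd_part_involutions (4 * j + 3)) = odd_part_mid (Suc j) + odd_part_gap (Suc j)"
  by (rule odd_part_involutions_eqI, rule num_involutions_formula,
      use odd_odd_part_mid even_odd_part_gap in force)+

section \<open>Periodicity of the recurrence under shifts of j\<close>

text \<open>Index 0 is excluded: the backward extension is not periodic there.\<close>

definition shift_periodic :: "nat \<Rightarrow> bool" where
  "shift_periodic P \<longleftrightarrow> (\<forall>j. 2 * int P dvd odd_part_mid (Suc j + P) - odd_part_mid (Suc j) \<and>
    2 * int P dvd odd_part_gap (Suc j + P) - odd_part_gap (Suc j))"

text \<open>Subtract the recurrence at an index from the recurrence shifted by \<open>P\<close>,
  divide by \<open>2 * int P\<close>, and reduce modulo 2.\<close>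

lemma shift_quotients:
  assumes P: "P > 0"
    and x: "\<And>j. odd_part_mid (Suc j + P) = odd_part_mid (Suc j) + 2 * int P * x j"
    and y: "\<And>j. odd_part_gap (Suc j + P) = odd_part_gap (Suc j) + 2 * int P * y j"
  shows "odd (y j)" "even (x (Suc j)) \<longleftrightarrow> odd (x j)"
proof -
  have "odd (odd_part_mid j + odd_part_gap j)" for j
    using odd_odd_part_mid even_odd_part_gap by auto
  note D = this
  show "odd (y j)"
  proof (cases j)
    \<comment> \<open>No quotients exist before index 1, but
      \<open>odd_part_gap (Suc 0) = 0\<close>, so the recurrence gives \<open>y 0\<close>
      directly.\<close>
    case 0
    have "2 * int P * y 0 = 2 * int P * ((4 * int P + 1) * (odd_part_mid P + odd_part_gap P))"
      using y[of 0] by (simp add: algebra_simps)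
    then have "y 0 = (4 * int P + 1) * (odd_part_mid P + odd_part_gap P)"
      using P by simp
    then show ?thesis using 0 D[of P] by simp
  next
    case (Suc i)
    have "odd_part_gap (Suc (Suc i) + P) =
        2 * (int (Suc i) + int P) * (4 * (int (Suc i) + int P) + 1) *
        (odd_part_mid (Suc i + P) + odd_part_gap (Suc i + P))"
      using odd_part_gap.simps(2)[of "Suc i + P"] by (simp del: odd_part_mid.simps odd_part_gap.simps)
    \<comment> \<open>With k = \<open>Suc i\<close>, the coefficient 2k(4k+1) grows by 2P(8k+4P+1)
      under the shift. This odd cofactor multiplies an odd sum; the remaining term is even.\<close>
    then have "2 * int P * y (Suc i) = 2 * int P *
       ((8 * int (Suc i) + 4 * int P + 1) * (odd_part_mid (Suc i) + odd_part_gap (Suc i)) +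
        2 * (int (Suc i) + int P) * (4 * (int (Suc i) + int P) + 1) * (x i + y i))"
      unfolding y x odd_part_gap.simps(2)[of "Suc i"] by algebra
    then have "y (Suc i) =
       (8 * int (Suc i) + 4 * int P + 1) * (odd_part_mid (Suc i) + odd_part_gap (Suc i)) +
        2 * (int (Suc i) + int P) * (4 * (int (Suc i) + int P) + 1) * (x i + y i)"
      using P by simp
    then show ?thesis using Suc D[of "Suc i"] by simp
  qed
  have "odd_part_mid (Suc (Suc j) + P) =
      (8 * (int (Suc j) + int P) ^ 2 + 10 * (int (Suc j) + int P) + 1) * odd_part_mid (Suc j + P) +
      (8 * (int (Suc j) + int P) + 2) * odd_part_gap (Suc j + P)"
    using odd_part_mid.simps(2)[of "Suc j + P"] by (simp del: odd_part_mid.simps odd_part_gap.simps)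
  \<comment> \<open>With k = \<open>Suc j\<close>, the coefficient 8k^2+10k+1 grows by 2P(8k+4P+5).
    Modulo 2 the bracket is therefore 1 + \<open>x j\<close>.\<close>
  then have "2 * int P * x (Suc j) = 2 * int P *
     ((8 * int (Suc j) + 4 * int P + 5) * odd_part_mid (Suc j) + 4 * odd_part_gap (Suc j) +
      (8 * (int (Suc j) + int P) ^ 2 + 10 * (int (Suc j) + int P) + 1) * x j +
      (8 * (int (Suc j) + int P) + 2) * y j)"
    unfolding y x odd_part_mid.simps(2)[of "Suc j"] by algebra
  then have "x (Suc j) =
     (8 * int (Suc j) + 4 * int P + 5) * odd_part_mid (Suc j) + 4 * odd_part_gap (Suc j) +
      (8 * (int (Suc j) + int P) ^ 2 + 10 * (int (Suc j) + int P) + 1) * x j +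
      (8 * (int (Suc j) + int P) + 2) * y j"
    using P by simp
  then show "even (x (Suc j)) \<longleftrightarrow> odd (x j)"
    using odd_odd_part_mid[of "Suc j"] by simp
qed

lemma shift_periodic_obtain:
  assumes "shift_periodic P"
  obtains x y where "\<And>j. odd_part_mid (Suc j + P) = odd_part_mid (Suc j) + 2 * int P * x j"
    and "\<And>j. odd_part_gap (Suc j + P) = odd_part_gap (Suc j) + 2 * int P * y j"
proof -
  have "\<exists>u. odd_part_mid (Suc j + P) = odd_part_mid (Suc j) + 2 * int P * u"
    "\<exists>v. odd_part_gap (Suc j + P) = odd_part_gap (Suc j) + 2 * int P * v" for j
    using assms unfolding shift_periodic_def dvd_def by (metis add.commute diff_add_cancel)+
  then show thesis using that by metis
qed

lemma shift_periodic_double: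
  assumes P: "P > 0" "even P" and per: "shift_periodic P"
  shows "shift_periodic (2 * P)"
proof -
  obtain x y where xy: "\<And>j. odd_part_mid (Suc j + P) = odd_part_mid (Suc j) + 2 * int P * x j"
    "\<And>j. odd_part_gap (Suc j + P) = odd_part_gap (Suc j) + 2 * int P * y j"
    using shift_periodic_obtain[OF per] by blast
  note q = shift_quotients[OF P(1) xy]
  \<comment> \<open>The parity of \<open>x\<close> alternates, so an even shift \<open>P\<close>
    preserves it.\<close>
  have "even (x (j + k)) \<longleftrightarrow> (even (x j) \<longleftrightarrow> even k)" for j k
    by (induction k) (auto simp: q(2))
  then have ex: "even (x j + x (j + P))" for j
    using P(2) by simp
  have ey: "even (y j + y (j + P))" for j
    using q(1) by simp
  have "odd_part_mid (Suc j + 2 * P) - odd_part_mid (Suc j) = 2 * int P * (x j + x (j + P))"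
    "odd_part_gap (Suc j + 2 * P) - odd_part_gap (Suc j) = 2 * int P * (y j + y (j + P))" for j
  proof -
    have "Suc j + 2 * P = Suc (j + P) + P" "Suc (j + P) = Suc j + P" by simp_all
    then have "odd_part_mid (Suc j + 2 * P) = odd_part_mid (Suc j) + 2 * int P * x j + 2 * int P * x (j + P)"
      "odd_part_gap (Suc j + 2 * P) = odd_part_gap (Suc j) + 2 * int P * y j + 2 * int P * y (j + P)"
      using xy[of j] xy[of "j + P"] by metis+
    then show "odd_part_mid (Suc j + 2 * P) - odd_part_mid (Suc j) = 2 * int P * (x j + x (j + P))"
      "odd_part_gap (Suc j + 2 * P) - odd_part_gap (Suc j) = 2 * int P * (y j + y (j + P))"
      by algebra+
  qed
  moreover have "2 * int (2 * P) dvd 2 * int P * z" if "even z" for z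
    using mult_dvd_mono[OF dvd_refl[of "2 * int P"] that] by (simp add: ac_simps)
  ultimately show ?thesis
    unfolding shift_periodic_def using ex ey by (metis (no_types))
qed

text \<open>Here the divisibility is itself carried along by induction: the coefficient differences
  computed above, with P = 4, contain the factor 8 = 2P. The base case is a numerical
  evaluation.\<close>

lemma shift_periodic_4: "shift_periodic 4"
proof -
  have "8 dvd odd_part_mid (Suc j + 4) - odd_part_mid (Suc j) \<and>
    8 dvd odd_part_gap (Suc j + 4) - odd_part_gap (Suc j)" for j
  proof (induction j)
    case 0
    show ?case by (simp add: eval_nat_numeral)
  next
    case (Suc j)
    then obtain u v where uv: "odd_part_mid (Suc j + 4) = odd_part_mid (Suc j) + 8 * u"
      "odd_part_gap (Suc j + 4) = odd_part_gap (Suc j) + 8 * v"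
      unfolding dvd_def by (metis add.commute diff_add_cancel)
    have "odd_part_mid (Suc (Suc j) + 4) =
      (8 * (int (Suc j) + 4) ^ 2 + 10 * (int (Suc j) + 4) + 1) * odd_part_mid (Suc j + 4) +
      (8 * (int (Suc j) + 4) + 2) * odd_part_gap (Suc j + 4)"
      "odd_part_gap (Suc (Suc j) + 4) =
        2 * (int (Suc j) + 4) * (4 * (int (Suc j) + 4) + 1) *
        (odd_part_mid (Suc j + 4) + odd_part_gap (Suc j + 4))"
      using odd_part_mid.simps(2)[of "Suc j + 4"] odd_part_gap.simps(2)[of "Suc j + 4"]
      by (simp_all del: odd_part_mid.simps odd_part_gap.simps)
    then have "odd_part_mid (Suc (Suc j) + 4) - odd_part_mid (Suc (Suc j)) = 8 *
     ((8 * int (Suc j) + 16 + 5) * odd_part_mid (Suc j) + 4 * odd_part_gap (Suc j) +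
      (8 * (int (Suc j) + 4) ^ 2 + 10 * (int (Suc j) + 4) + 1) * u +
      (8 * (int (Suc j) + 4) + 2) * v)"
      "odd_part_gap (Suc (Suc j) + 4) - odd_part_gap (Suc (Suc j)) = 8 *
       ((8 * int (Suc j) + 16 + 1) * (odd_part_mid (Suc j) + odd_part_gap (Suc j)) +
        2 * (int (Suc j) + 4) * (4 * (int (Suc j) + 4) + 1) * (u + v))"
      unfolding uv odd_part_mid.simps(2)[of "Suc j"] odd_part_gap.simps(2)[of "Suc j"] by algebra+
    then show ?case by (metis dvd_triv_left)
  qed
  then show ?thesis by (simp add: shift_periodic_def)
qed

lemma shift_periodic_power:
  assumes "m \<ge> 2"
  shows "shift_periodic (2 ^ m)"
  using assms
proof (induction m rule: dec_induct)
  case base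
  show ?case using shift_periodic_4 by simp
next
  case (step m)
  then show ?case using shift_periodic_double[of "2 ^ m"] by simp
qed

section \<open>Transfer to the odd parts at all indices\<close>

text \<open>In each class modulo 4 the odd part is a combination of \<open>odd_part_mid\<close> and
  \<open>odd_part_gap\<close> whose coefficients change by 0, 4P, 8P or 12P, all multiples of
  2P.\<close>

lemma odd_part_shift:
  assumes per: "shift_periodic P"
  shows "2 * int P dvd int (odd_part_involutions (n + 4 * P)) - int (odd_part_involutions n)"
    (is "?d dvd ?b (n + 4 * P) - ?b n")
proof -
  define C D where "C = odd_part_mid" and "D = odd_part_gap"
  have dvdC: "?d dvd C (Suc j + P) - C (Suc j)" and dvdD: "?d dvd D (Suc j + P) - D (Suc j)" for j
    using per by (auto simp: shift_periodic_def C_def D_def)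
  \<comment> \<open>replaces the missing periodicity at index 0\<close>
  have base: "?d dvd C P + 2 * D P - 1"
  proof -
    \<comment> \<open>Modulo 2P, one step of the recurrence from index \<open>P\<close> gives
      \<open>C P + 2 * D P\<close>, while \<open>C (Suc 0) = 1\<close>.\<close>
    have "C (Suc 0 + P) - C (Suc 0) =
        ?d * ((4 * int P + 5) * C P + 4 * D P) + (C P + 2 * D P - 1)"
      by (simp add: C_def D_def power2_eq_square algebra_simps)
    with dvdC[of 0] show ?thesis by (metis dvd_add_right_iff dvd_triv_left)
  qed
  have low: "?d dvd ((4 * int (j + P) + 1) * C (j + P) + 2 * D (j + P)) -
      ((4 * int j + 1) * C j + 2 * D j)" (is ?A)
    "?d dvd ((12 * int (j + P) + 1) * C (j + P) + (8 * int (j + P) + 2) * D (j + P)) -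
      ((12 * int j + 1) * C j + (8 * int j + 2) * D j)" (is ?B) for j
  proof -
    have "?A \<and> ?B"
    proof (cases j)
      case 0
      \<comment> \<open>At \<open>j = 0\<close> both combinations equal 1, and both shifted ones
        reduce to \<open>C P + 2 * D P\<close> modulo 2P, so \<open>base\<close> settles
        both.\<close>
      obtain k where "C P + 2 * D P - 1 = ?d * k" using base by (elim dvdE)
      then have "C P = 1 - 2 * D P + ?d * k" by simp
      then have "((4 * int (j + P) + 1) * C (j + P) + 2 * D (j + P)) -
            ((4 * int j + 1) * C j + 2 * D j) = ?d * (k + 2 * C P)"
          "((12 * int (j + P) + 1) * C (j + P) + (8 * int (j + P) + 2) * D (j + P)) -
            ((12 * int j + 1) * C j + (8 * int j + 2) * D j) = ?d * (k + 6 * C P + 4 * D P)"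
        using 0 by (simp_all add: C_def D_def algebra_simps)
      then show ?thesis by (metis dvd_triv_left)
    next
      case (Suc i)
      obtain k l where "C (Suc i + P) - C (Suc i) = ?d * k" "D (Suc i + P) - D (Suc i) = ?d * l"
        using dvdC[of i] dvdD[of i] by (elim dvdE)
      then have kl: "C (j + P) = C j + ?d * k" "D (j + P) = D j + ?d * l"
        using Suc by simp_all
      have "((4 * int (j + P) + 1) * C (j + P) + 2 * D (j + P)) -
            ((4 * int j + 1) * C j + 2 * D j) =
            ?d * (2 * C j + (4 * int (j + P) + 1) * k + 2 * l)"
          "((12 * int (j + P) + 1) * C (j + P) + (8 * int (j + P) + 2) * D (j + P)) -
            ((12 * int j + 1) * C j + (8 * int j + 2) * D j) =
            ?d * (6 * C j + 4 * D j + (12 * int (j + P) + 1) * k + (8 * int (j + P) + 2) * l)"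
        unfolding kl of_nat_add by algebra+
      then show ?thesis by (metis dvd_triv_left)
    qed
    then show ?A ?B by blast+
  qed
  define j where "j = n div 4"
  have "n mod 4 < 4" by simp
  then have "n mod 4 = 0 \<or> n mod 4 = 1 \<or> n mod 4 = 2 \<or> n mod 4 = 3" by linarith
  moreover have "n = 4 * j + n mod 4" by (simp add: j_def)
  ultimately consider "n = 4 * j" | "n = 4 * j + 1" | "n = 4 * j + 2" | "n = 4 * j + 3"
    by force
  then show ?thesis
  proof cases
    case 1
    then have "n + 4 * P = 4 * (j + P)" by simp
    with 1 low(1)[of j] show ?thesis unfolding C_def D_def by (simp only: odd_part_formula)
  next
    case 2
    then have "n + 4 * P = 4 * (j + P) + 1" by simp
    with 2 low(2)[of j] show ?thesis unfolding C_def D_def by (simp only: odd_part_formula)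
  next
    case 3
    then have "n + 4 * P = 4 * (j + P) + 2" by simp
    with 3 dvdC[of j] show ?thesis
      unfolding C_def D_def by (simp only: odd_part_formula add_Suc)
  next
    case 4
    then have "n + 4 * P = 4 * (j + P) + 3" by simp
    moreover have "?d dvd (C (Suc j + P) + D (Suc j + P)) - (C (Suc j) + D (Suc j))"
      using dvd_add[OF dvdC[of j] dvdD[of j]] by (simp add: algebra_simps C_def D_def del: odd_part_mid.simps odd_part_gap.simps)
    ultimately show ?thesis
      using 4 unfolding C_def D_def by (simp only: odd_part_formula add_Suc)
  qed
qed

section \<open>Divisors of periods and minimality\<close>

lemma mod_power_eq_iff_dvd:
  "a mod 2 ^ s = b mod (2 ^ s :: nat) \<longleftrightarrow> 2 ^ s dvd int a - int b"
  using mod_eq_dvd_iff[of "int a" "2 ^ s" "int b"] of_nat_eq_iff[where 'a = int, of "a mod 2 ^ s" "b mod 2 ^ s"]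
  by (simp add: zmod_int)

lemma is_period_shift:
  assumes "is_period a d"
  shows "a (n + k * d) = a n"
  using assms by (induction k arbitrary: n) (auto simp: is_period_def add.assoc[symmetric])

text \<open>Bezout in subtraction-free form needs only forward shifts: going from \<open>n\<close>
  by \<open>gcd d e\<close> and then by \<open>e * y\<close> lands on
  \<open>n + d * x\<close>.\<close>

lemma is_period_gcd:
  assumes d: "is_period a d" and e: "is_period a e"
  shows "is_period a (gcd d e)"
proof -
  have "d \<noteq> 0" using d by (simp add: is_period_def)
  then obtain x y where "d * x = e * y + gcd d e"
    using bezout_nat by blast
  then have "a (n + gcd d e) = a n" for n
    using is_period_shift[OF e, of "n + gcd d e" y] is_period_shift[OF d, of n x] by (simp add: ac_simps)
  then show ?thesis using \<open>d \<noteq> 0\<close> by (simp add: is_period_def)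
qed

lemma is_period_mult:
  assumes "is_period a d" "k > 0"
  shows "is_period a (d * k)"
  using assms is_period_shift[OF assms(1), of _ k] by (simp add: is_period_def mult.commute)

lemma not_period_power:
  assumes "s \<ge> 3"
  shows "\<not> is_period (\<lambda>n. odd_part_involutions n mod 2 ^ s) (2 ^ s)"
proof
  assume "is_period (\<lambda>n. odd_part_involutions n mod 2 ^ s) (2 ^ s)"
  then have per: "2 ^ s dvd int (odd_part_involutions (n + 2 ^ s)) - int (odd_part_involutions n)" for n
    by (simp add: is_period_def mod_power_eq_iff_dvd)
  show False
  proof (cases "s = 3")
    \<comment> \<open>Here P would be 2, below the start P = 4 of the doubling, so two values are
      compared.\<close>
    case True
    have "int (odd_part_involutions 0) = 1" "int (odd_part_involutions 8) = 191"
      using odd_part_formula(1)[of 0] odd_part_formula(1)[of 2] by (simp_all add: eval_nat_numeral)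
    then show False using per[of 0] True by simp
  next
    case False
    define P :: nat where "P = 2 ^ (s - 2)"
    have "s = 2 + (s - 2)" using assms by simp
    then have "(2 :: nat) ^ s = 2 ^ 2 * 2 ^ (s - 2)" by (metis power_add)
    then have s: "2 ^ s = 4 * P" by (simp add: P_def)
    then have s': "(2 :: int) ^ s = 4 * int P"
      by (metis of_nat_mult of_nat_numeral of_nat_power)
    have "shift_periodic P"
      unfolding P_def using False assms by (intro shift_periodic_power) auto
    then obtain x y where xy: "\<And>j. odd_part_mid (Suc j + P) = odd_part_mid (Suc j) + 2 * int P * x j"
      "\<And>j. odd_part_gap (Suc j + P) = odd_part_gap (Suc j) + 2 * int P * y j"
      using shift_periodic_obtain by blast
    have P: "P > 0" by (simp add: P_def)
    \<comment> \<open>The indices 2 and 3 are the first ones expressed through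
      \<open>odd_part_mid\<close> and \<open>odd_part_gap\<close> at index 1. Subtracting the two
      divisibilities isolates the gap, whose quotient \<open>y 0\<close> would have to be
      even.\<close>
    have e: "2 + 2 ^ s = 4 * P + 2" "3 + 2 ^ s = 4 * P + 3" using s by simp_all
    have C: "4 * int P dvd odd_part_mid (Suc P) - odd_part_mid (Suc 0)"
      using per[of 2] odd_part_formula(3)[of 0] odd_part_formula(3)[of P]
      unfolding e s' by (simp only: mult_0_right add_0)
    have "4 * int P dvd (odd_part_mid (Suc P) + odd_part_gap (Suc P)) -
        (odd_part_mid (Suc 0) + odd_part_gap (Suc 0))"
      using per[of 3] odd_part_formula(4)[of 0] odd_part_formula(4)[of P]
      unfolding e s' by (simp only: mult_0_right add_0)
    from dvd_diff[OF this C] have "4 * int P dvd odd_part_gap (Suc P) - odd_part_gap (Suc 0)"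
      by (simp add: algebra_simps del: odd_part_mid.simps odd_part_gap.simps)
    then have "2 * int P * 2 dvd 2 * int P * y 0"
      using xy(2)[of 0] by (simp add: ac_simps del: odd_part_gap.simps)
    then have "even (y 0)"
      using P by (subst (asm) dvd_times_left_cancel_iff) auto
    then show False using shift_quotients(1)[OF P xy] by blast
  qed
qed

theorem theorem6p6:
  fixes s :: nat
  assumes "s \<ge> 3"
  shows "is_smallest_period (\<lambda>n. odd_part_involutions n mod 2 ^ s) (2 ^ (s + 1))"
proof -
  let ?a = "\<lambda>n. odd_part_involutions n mod 2 ^ s"
  obtain m where m: "s = Suc m" "m \<ge> 2" using assms by (cases s) auto
  \<comment> \<open>For P = \<open>2 ^ m\<close> the modulus 2P is \<open>2 ^ s\<close> and the
    shift 4P is \<open>2 ^ (s + 1)\<close>.\<close>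
  have period: "is_period ?a (2 ^ (s + 1))"
    using odd_part_shift[OF shift_periodic_power[OF m(2)]]
    unfolding is_period_def mod_power_eq_iff_dvd by (simp add: m(1))
  have "2 ^ (s + 1) \<le> d" if d: "is_period ?a d" for d
  proof (rule ccontr)
    assume "\<not> 2 ^ (s + 1) \<le> d"
    \<comment> \<open>The gcd of a smaller period with \<open>2 ^ (s + 1)\<close> is again a period,
      a proper divisor of this power, and hence divides \<open>2 ^ s\<close>.\<close>
    obtain i where i: "i \<le> s + 1" "gcd d (2 ^ (s + 1)) = 2 ^ i"
      using divides_primepow_nat[OF two_is_prime_nat] gcd_dvd2 by blast
    have "d > 0" using d by (simp add: is_period_def)
    then have "(2 :: nat) ^ i \<le> d" using i(2) by (metis dvd_imp_le gcd_dvd1)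
    with \<open>\<not> 2 ^ (s + 1) \<le> d\<close> have "i \<noteq> s + 1" by auto
    with i have "i \<le> s" by simp
    have "is_period ?a (2 ^ i * 2 ^ (s - i))"
      using is_period_gcd[OF d period] unfolding i(2) by (rule is_period_mult) simp
    then have "is_period ?a (2 ^ s)"
      using \<open>i \<le> s\<close> by (simp flip: power_add)
    then show False using not_period_power[OF assms] by blast
  qed
  with period show ?thesis by (simp add: is_smallest_period_def)
qed

end
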